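(* Let $C$ be a concept class over a domain $X$. If $\mathcal A$ is an $(\alpha,\beta,\epsilon,\delta,n,m)$-PSSL for $C$, then $\mathcal A$ (viewed as the active learner that queries the labels of the fixed indices $1,\dots,m$ of its labeled entries) is an $(\alpha,\beta,\epsilon,\delta,n,m)$-TPAL (transcript-private active learner) for $C$.
   Context: A concept over a domain $X$ is a function $c:X\to\{0,1\}$; a concept class is a set of concepts. For a distribution $\mu$ on $X$, $\mathrm{error}_\mu(c,h)=\Pr_{x\sim\mu}[h(x)\ne c(x)]$. Differential privacy: two databases of the same size are neighboring if they differ in exactly one entry. A randomized algorithm $\mathcal A$ is $(\epsilon,\delta)$-differentially private if for all neighboring databases $S_1,S_2$ and all sets $F$ of outputs, $\Pr[\mathcal A(S_1)\in F]\le e^{\epsilon}\Pr[\mathcal A(S_2)\in F]+\delta$. Semi-supervised learner: an algorithm $\mathcal A$ is an $(\alpha,\beta,n,m)$-SSL for $C$ (with $m\le n$) if for every $c\in C$ and every distribution $\mu$ on $X$ the following holds: if $D=(x_i,y_i)_{i=1}^n\in(X\times\{0,1,\bot\})^n$ where the $x_i$ are i.i.d. from $\mu$, $y_i=c(x_i)$ for $i\le m$, and $y_i=\bot$ for $i>m$, then $\Pr[\mathcal A(D)=h \text{ with } \mathrm{error}_\mu(c,h)>\alpha]\le\beta$. An $(\alpha,\beta,\epsilon,\delta,n,m)$-PSSL for $C$ is an $(\alpha,\beta,n,m)$-SSL for $C$ that is $(\epsilon,\delta)$-differentially private as an algorithm on databases in $(X\times\{0,1,\bot\})^n$, where the first $m$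 entries are labeled and the last $n-m$ entries are unlabeled. The learner has no control over which examples are labeled, and the indices of the labeled examples are publicly known. Active learner: an interactive randomized algorithm $\mathcal A$ holds an unlabeled database $D=(x_i)_{i=1}^n\in X^n$; for at most $m$ rounds it (adaptively) outputs an index $i\in\{1,\dots,n\}$ and receives an answer $y_i\in\{0,1\}$; it then outputs a hypothesis $h$. It is an $(\alpha,\beta,n,m)$-AL for $C$ if for all $c\in C$ and all distributions $\mu$ on $X$, when the $x_i$ are i.i.d. from $\mu$ and each query $i$ is answered by $c(x_i)$, $\Pr[\mathrm{error}_\mu(c,h)\le\alpha]\ge1-\beta$. The transcript of an execution is the ordered sequence of indices that $\mathcal A$ queries. $\mathcal A$ is an $(\alpha,\beta,\epsilon,\delta,n,m)$-TPAL for $C$ if it is an $(\alpha,\beta,n,m)$-AL for $C$ and the algorithm whose input is a fully labeled sample in $(X\times\{0,1\})^n$ (query $i$ answered by the label $y_i$) and whose output is the pair ($h$, transcript) is $(\epsilon,\delta)$-differentially private. *)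

theory Defs
  imports "HOL-Probability.Probability"
begin

text \<open>
  The domain is a measurable space \<open>MX\<close>, concepts are predicates on it, and hypotheses are the
  points of a measurable space \<open>MH\<close> of predicates. Randomized algorithms are Markov kernels into
  \<^const>\<open>prob_algebra\<close>. A database of size \<open>n\<close> is an extensional function on \<open>{1..n}\<close>. The label
  set \<open>{0, 1, \<bottom>}\<close> is the type \<^typ>\<open>bool option\<close> with \<^const>\<open>None\<close> for \<open>\<bottom>\<close>.
\<close>

definition error :: "'x measure \<Rightarrow> ('x \<Rightarrow> bool) \<Rightarrow> ('x \<Rightarrow> bool) \<Rightarrow> real" where
  "error \<mu> c h = measure \<mu> {x \<in> space \<mu>. h x \<noteq> c x}"

definition distribution_on :: "'x measure \<Rightarrow> 'x measure \<Rightarrow> bool" where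
  "distribution_on MX \<mu> \<longleftrightarrow> prob_space \<mu> \<and> sets \<mu> = sets MX"

definition concept_class :: "'x measure \<Rightarrow> ('x \<Rightarrow> bool) set \<Rightarrow> bool" where
  "concept_class MX C \<longleftrightarrow> C \<subseteq> MX \<rightarrow>\<^sub>M count_space UNIV"

text \<open>
  The measurability needed for the events \<open>h x \<noteq> c x\<close> and \<open>error \<mu> c h > \<alpha>\<close> to have a probability.
  It holds, for instance, whenever evaluation \<open>(h, x) \<mapsto> h x\<close> is jointly measurable.
\<close>

definition hypothesis_space ::
    "'x measure \<Rightarrow> ('x \<Rightarrow> bool) set \<Rightarrow> ('x \<Rightarrow> bool) measure \<Rightarrow> bool" where
  "hypothesis_space MX C MH \<longleftrightarrow>
     space MH \<subseteq> MX \<rightarrow>\<^sub>M count_space UNIV \<and>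
     (\<forall>c\<in>C. \<forall>\<mu>. distribution_on MX \<mu> \<longrightarrow> error \<mu> c \<in> borel_measurable MH)"

definition database_space :: "nat \<Rightarrow> 'd measure \<Rightarrow> (nat \<Rightarrow> 'd) measure" where
  "database_space n M = (\<Pi>\<^sub>M i\<in>{1..n}. M)"

definition neighboring :: "nat \<Rightarrow> (nat \<Rightarrow> 'd) \<Rightarrow> (nat \<Rightarrow> 'd) \<Rightarrow> bool" where
  "neighboring n S\<^sub>1 S\<^sub>2 \<longleftrightarrow> (\<exists>!i. i \<in> {1..n} \<and> S\<^sub>1 i \<noteq> S\<^sub>2 i)"

definition differentially_private ::
    "real \<Rightarrow> real \<Rightarrow> nat \<Rightarrow> (nat \<Rightarrow> 'd) set \<Rightarrow> 'o measure \<Rightarrow> ((nat \<Rightarrow> 'd) \<Rightarrow> 'o measure) \<Rightarrow> bool" where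
  "differentially_private \<epsilon> \<delta> n \<D> N \<A> \<longleftrightarrow>
     (\<forall>S\<^sub>1\<in>\<D>. \<forall>S\<^sub>2\<in>\<D>. neighboring n S\<^sub>1 S\<^sub>2 \<longrightarrow>
        (\<forall>F\<in>sets N. measure (\<A> S\<^sub>1) F \<le> exp \<epsilon> * measure (\<A> S\<^sub>2) F + \<delta>))"

definition ssl_database_space :: "nat \<Rightarrow> 'x measure \<Rightarrow> (nat \<Rightarrow> 'x \<times> bool option) measure" where
  "ssl_database_space n MX = database_space n (MX \<Otimes>\<^sub>M count_space UNIV)"

text \<open>Which entries are labeled is public: the first \<open>m\<close> are and the others are not.\<close>

definition ssl_databases :: "nat \<Rightarrow> nat \<Rightarrow> 'x measure \<Rightarrow> (nat \<Rightarrow> 'x \<times> bool option) set" where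
  "ssl_databases n m MX =
     {D \<in> space (ssl_database_space n MX). \<forall>i\<in>{1..n}. snd (D i) \<noteq> None \<longleftrightarrow> i \<le> m}"

definition ssl_sample ::
    "nat \<Rightarrow> nat \<Rightarrow> ('x \<Rightarrow> bool) \<Rightarrow> (nat \<Rightarrow> 'x) \<Rightarrow> (nat \<Rightarrow> 'x \<times> bool option)" where
  "ssl_sample n m c x = (\<lambda>i\<in>{1..n}. (x i, if i \<le> m then Some (c (x i)) else None))"

definition SSL ::
    "real \<Rightarrow> real \<Rightarrow> nat \<Rightarrow> nat \<Rightarrow> 'x measure \<Rightarrow> ('x \<Rightarrow> bool) measure \<Rightarrow> ('x \<Rightarrow> bool) set \<Rightarrow>
     ((nat \<Rightarrow> 'x \<times> bool option) \<Rightarrow> ('x \<Rightarrow> bool) measure) \<Rightarrow> bool" where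
  "SSL \<alpha> \<beta> n m MX MH C \<A> \<longleftrightarrow>
     m \<le> n \<and>
     \<A> \<in> ssl_database_space n MX \<rightarrow>\<^sub>M prob_algebra MH \<and>
     (\<forall>c\<in>C. \<forall>\<mu>. distribution_on MX \<mu> \<longrightarrow>
        measure (database_space n \<mu> \<bind> (\<lambda>x. \<A> (ssl_sample n m c x)))
          {h \<in> space MH. error \<mu> c h > \<alpha>} \<le> \<beta>)"

definition PSSL ::
    "real \<Rightarrow> real \<Rightarrow> real \<Rightarrow> real \<Rightarrow> nat \<Rightarrow> nat \<Rightarrow>
     'x measure \<Rightarrow> ('x \<Rightarrow> bool) measure \<Rightarrow> ('x \<Rightarrow> bool) set \<Rightarrow>
     ((nat \<Rightarrow> 'x \<times> bool option) \<Rightarrow> ('x \<Rightarrow> bool) measure) \<Rightarrow> bool" where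
  "PSSL \<alpha> \<beta> \<epsilon> \<delta> n m MX MH C \<A> \<longleftrightarrow>
     SSL \<alpha> \<beta> n m MX MH C \<A> \<and>
     differentially_private \<epsilon> \<delta> n (ssl_databases n m MX) MH \<A>"

text \<open>
  An interactive learner sees its unlabeled database, the list of (query, answer) pairs so far in
  chronological order, and a private memory in which it may keep, e.g., random bits from earlier
  rounds. In each round \<open>query\<close> yields an index to be queried, or \<^const>\<open>None\<close> if the learner asks
  no more, together with the new memory; \<open>hypothesis\<close> yields the final output.
\<close>

type_synonym ('x, 's) view = "(nat \<Rightarrow> 'x) \<times> (nat \<times> bool) list \<times> 's"

record ('x, 's) interactive_learner =
  memory :: "'s measure"
  init :: 's
  query :: "('x, 's) view \<Rightarrow> (nat option \<times> 's) measure"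
  hypothesis :: "('x, 's) view \<Rightarrow> ('x \<Rightarrow> bool) measure"

definition view_space :: "nat \<Rightarrow> 'x measure \<Rightarrow> 's measure \<Rightarrow> ('x, 's) view measure" where
  "view_space n MX MM = database_space n MX \<Otimes>\<^sub>M count_space UNIV \<Otimes>\<^sub>M MM"

definition query_space :: "nat \<Rightarrow> nat option measure" where
  "query_space n = count_space (insert None (Some ` {1..n}))"

definition interactive_learner ::
    "nat \<Rightarrow> 'x measure \<Rightarrow> ('x \<Rightarrow> bool) measure \<Rightarrow> ('x, 's) interactive_learner \<Rightarrow> bool" where
  "interactive_learner n MX MH L \<longleftrightarrow>
     init L \<in> space (memory L) \<and>
     query L \<in> view_space n MX (memory L) \<rightarrow>\<^sub>M prob_algebra (query_space n \<Otimes>\<^sub>M memory L) \<and>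
     hypothesis L \<in> view_space n MX (memory L) \<rightarrow>\<^sub>M prob_algebra MH"

definition transcript_space :: "('x \<Rightarrow> bool) measure \<Rightarrow> (('x \<Rightarrow> bool) \<times> nat list) measure" where
  "transcript_space MH = MH \<Otimes>\<^sub>M count_space UNIV"

text \<open>
  \<open>interact MH L y D k hist s\<close> is the joint law of the hypothesis and the full transcript when the
  learner \<open>L\<close> continues from history \<open>hist\<close> and memory \<open>s\<close> with at most \<open>k\<close> further rounds, query
  \<open>i\<close> being answered by \<open>y i\<close>.
\<close>

definition finish ::
    "('x \<Rightarrow> bool) measure \<Rightarrow> ('x, 's) interactive_learner \<Rightarrow> ('x, 's) view \<Rightarrow>
     (('x \<Rightarrow> bool) \<times> nat list) measure" where
  "finish MH L v =
     hypothesis L v \<bind> (\<lambda>h. return (transcript_space MH) (h, map fst (fst (snd v))))"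

primrec interact ::
    "('x \<Rightarrow> bool) measure \<Rightarrow> ('x, 's) interactive_learner \<Rightarrow> (nat \<Rightarrow> bool) \<Rightarrow> (nat \<Rightarrow> 'x) \<Rightarrow>
     nat \<Rightarrow> (nat \<times> bool) list \<Rightarrow> 's \<Rightarrow> (('x \<Rightarrow> bool) \<times> nat list) measure" where
  "interact MH L y D 0 hist s = finish MH L (D, hist, s)"
| "interact MH L y D (Suc k) hist s =
     query L (D, hist, s) \<bind> (\<lambda>(q, s').
       case q of
         None \<Rightarrow> finish MH L (D, hist, s')
       | Some i \<Rightarrow> interact MH L y D k (hist @ [(i, y i)]) s')"

definition execution ::
    "('x \<Rightarrow> bool) measure \<Rightarrow> nat \<Rightarrow> ('x, 's) interactive_learner \<Rightarrow> (nat \<Rightarrow> bool) \<Rightarrow> (nat \<Rightarrow> 'x) \<Rightarrow>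
     (('x \<Rightarrow> bool) \<times> nat list) measure" where
  "execution MH m L y D = interact MH L y D m [] (init L)"

definition AL ::
    "real \<Rightarrow> real \<Rightarrow> nat \<Rightarrow> nat \<Rightarrow> 'x measure \<Rightarrow> ('x \<Rightarrow> bool) measure \<Rightarrow> ('x \<Rightarrow> bool) set \<Rightarrow>
     ('x, 's) interactive_learner \<Rightarrow> bool" where
  "AL \<alpha> \<beta> n m MX MH C L \<longleftrightarrow>
     interactive_learner n MX MH L \<and>
     (\<forall>c\<in>C. \<forall>\<mu>. distribution_on MX \<mu> \<longrightarrow>
        measure (database_space n \<mu> \<bind> (\<lambda>x. execution MH m L (\<lambda>i. c (x i)) x))
          {(h, t). h \<in> space MH \<and> error \<mu> c h \<le> \<alpha>} \<ge> 1 - \<beta>)"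

definition transcript_algorithm ::
    "('x \<Rightarrow> bool) measure \<Rightarrow> nat \<Rightarrow> nat \<Rightarrow> ('x, 's) interactive_learner \<Rightarrow>
     (nat \<Rightarrow> 'x \<times> bool) \<Rightarrow> (('x \<Rightarrow> bool) \<times> nat list) measure" where
  "transcript_algorithm MH n m L S =
     execution MH m L (\<lambda>i. snd (S i)) (\<lambda>i\<in>{1..n}. fst (S i))"

definition TPAL ::
    "real \<Rightarrow> real \<Rightarrow> real \<Rightarrow> real \<Rightarrow> nat \<Rightarrow> nat \<Rightarrow>
     'x measure \<Rightarrow> ('x \<Rightarrow> bool) measure \<Rightarrow> ('x \<Rightarrow> bool) set \<Rightarrow>
     ('x, 's) interactive_learner \<Rightarrow> bool" where
  "TPAL \<alpha> \<beta> \<epsilon> \<delta> n m MX MH C L \<longleftrightarrow>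
     AL \<alpha> \<beta> n m MX MH C L \<and>
     differentially_private \<epsilon> \<delta> n
       (space (database_space n (MX \<Otimes>\<^sub>M count_space UNIV)))
       (transcript_space MH) (transcript_algorithm MH n m L)"

text \<open>
  It queries \<open>1, \<dots>, m\<close> in this order and then runs \<open>\<A>\<close> on the database in which every index that
  was queried carries the answer received and every other index carries \<open>\<bottom>\<close> (both are what
  \<^const>\<open>map_of\<close> returns on the history). It uses no memory.
\<close>

definition active_of_ssl ::
    "nat \<Rightarrow> nat \<Rightarrow> ((nat \<Rightarrow> 'x \<times> bool option) \<Rightarrow> ('x \<Rightarrow> bool) measure) \<Rightarrow>
     ('x, unit) interactive_learner" where
  "active_of_ssl n m \<A> =
     \<lparr> memory = count_space UNIV,
       init = (),
       query = (\<lambda>(D, hist, s). return (query_space n \<Otimes>\<^sub>M count_space UNIV)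
         (if length hist < m then Some (Suc (length hist)) else None, ())),
       hypothesis = (\<lambda>(D, hist, s). \<A> (\<lambda>i\<in>{1..n}. (D i, map_of hist i))) \<rparr>"

end

theory Submission
  imports Defs
begin

text \<open>
  The transcript of the learner is always \<open>1, \<dots>, m\<close>, so its output law is the image of the law
  of \<open>\<A>\<close> under pairing with a constant, and accuracy carries over. For privacy, fully labeled
  neighbors are turned into neighbors for \<open>\<A>\<close> by erasing the labels beyond \<open>m\<close>, unless they
  differ only in an erased label; then \<open>\<A>\<close> sees equal inputs and \<open>\<epsilon>, \<delta> \<ge> 0\<close> suffices.
\<close>

text \<open>The history is the graph of \<open>y\<close> over a list, so looking up an index in it
  restricts \<open>Some \<circ> y\<close> to the elements of that list. This evaluates the database
  that \<open>active_of_ssl\<close> rebuilds after its \<open>m\<close> queries.\<close>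

lemma map_of_map_Pair_upt:
  "map_of (map (\<lambda>i. (i, y i)) [1..<Suc m]) i = (if i \<in> {1..m} then Some (y i) else None)"
proof -
  have "map_of (map (\<lambda>i. (i, y i)) [1..<Suc m]) i = ((Some \<circ> y) |` set [1..<Suc m]) i"
    by (simp only: map_of_map_restrict)
  then show ?thesis
    by (simp add: restrict_map_def less_Suc_eq_le)
qed

section \<open>Measurability of executions\<close>

text \<open>Binding to a point mass is a push-forward. In this form both the measurability of
  \<open>finish\<close> and the output law of a concrete learner can be read off.\<close>

lemma finish_eq_distr:
  assumes L: "interactive_learner n MX MH L"
    and v: "v \<in> space (view_space n MX (memory L))"
  shows "finish MH L v =
    distr (hypothesis L v) (transcript_space MH) (\<lambda>h. (h, map fst (fst (snd v))))"
proof -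
  have "hypothesis L v \<in> space (prob_algebra MH)"
    using L v by (auto simp: interactive_learner_def intro: measurable_space)
  then have "prob_space (hypothesis L v)" and [measurable_cong]: "sets (hypothesis L v) = sets MH"
    by (auto simp: space_prob_algebra)
  then show ?thesis
    unfolding finish_def transcript_space_def
    by (intro bind_return_distr' prob_space.not_empty) simp_all
qed

lemma measurable_finish:
  assumes L: "interactive_learner n MX MH L"
  shows "finish MH L \<in> view_space n MX (memory L) \<rightarrow>\<^sub>M prob_algebra (transcript_space MH)"
proof -
  have h: "hypothesis L \<in> view_space n MX (memory L) \<rightarrow>\<^sub>M prob_algebra MH"
    using L by (simp add: interactive_learner_def)
  have [measurable]: "(\<lambda>v. map fst (fst (snd v))) \<in> view_space n MX (memory L) \<rightarrow>\<^sub>M count_space UNIV"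
    unfolding view_space_def by measurable
  have "(\<lambda>v. distr (hypothesis L v) (transcript_space MH) (\<lambda>h. (h, map fst (fst (snd v)))))
      \<in> view_space n MX (memory L) \<rightarrow>\<^sub>M prob_algebra (transcript_space MH)"
    by (rule measurable_distr_prob_space2[OF h]) (unfold transcript_space_def, measurable)
  then show ?thesis
    by (subst measurable_cong[OF finish_eq_distr[OF L]])
qed

lemma measurable_view:
  assumes "D \<in> space (database_space n MX)"
  shows "(\<lambda>s. (D, hist, s)) \<in> MM \<rightarrow>\<^sub>M view_space n MX MM"
  using assms unfolding view_space_def by measurable

text \<open>Induction on the number of rounds left, for all histories at once because each round
  extends the history. The database stays fixed, so only the dependence on the memory matters. The
  second claim concerns the continuation of a round; it is what later lets
  \<open>bind_return\<close> resolve a deterministic query.\<close>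

lemma measurable_interact:
  assumes L: "interactive_learner n MX MH L"
    and D: "D \<in> space (database_space n MX)"
  shows "interact MH L y D k hist \<in> memory L \<rightarrow>\<^sub>M prob_algebra (transcript_space MH)"
    and "(\<lambda>(q, s'). case q of
         None \<Rightarrow> finish MH L (D, hist, s')
       | Some i \<Rightarrow> interact MH L y D k (hist @ [(i, y i)]) s')
      \<in> query_space n \<Otimes>\<^sub>M memory L \<rightarrow>\<^sub>M prob_algebra (transcript_space MH)"
proof -
  have fin: "(\<lambda>s. finish MH L (D, hist, s)) \<in> memory L \<rightarrow>\<^sub>M prob_algebra (transcript_space MH)"
    for hist
    by (rule measurable_compose[OF measurable_view[OF D] measurable_finish[OF L]])
  have step: "(\<lambda>(q, s'). case q of
         None \<Rightarrow> finish MH L (D, hist, s')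
       | Some i \<Rightarrow> interact MH L y D k (hist @ [(i, y i)]) s')
      \<in> query_space n \<Otimes>\<^sub>M memory L \<rightarrow>\<^sub>M prob_algebra (transcript_space MH)"
    if "\<And>hist. interact MH L y D k hist \<in> memory L \<rightarrow>\<^sub>M prob_algebra (transcript_space MH)"
    for k hist
    \<comment> \<open>Queries form a countable discrete space, so joint measurability reduces to
      measurability in \<open>s'\<close> for each query separately.\<close>
    unfolding query_space_def using fin that
    by (intro measurable_pair_measure_countable1) (auto split: option.split)
  have int: "interact MH L y D k hist \<in> memory L \<rightarrow>\<^sub>M prob_algebra (transcript_space MH)"
    for k hist
  proof (induction k arbitrary: hist)
    case 0
    show ?case
      using fin[of hist] by simp
  next
    case (Suc k)
    have "(\<lambda>s. query L (D, hist, s)) \<in> memory L \<rightarrow>\<^sub>M prob_algebra (query_space n \<Otimes>\<^sub>M memory L)"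
      using L by (intro measurable_compose[OF measurable_view[OF D]])
        (simp add: interactive_learner_def)
    from measurable_bind_prob_space[OF this step[OF Suc]] show ?case
      by simp
  qed
  show "interact MH L y D k hist \<in> memory L \<rightarrow>\<^sub>M prob_algebra (transcript_space MH)"
    by (rule int)
  show "(\<lambda>(q, s'). case q of
         None \<Rightarrow> finish MH L (D, hist, s')
       | Some i \<Rightarrow> interact MH L y D k (hist @ [(i, y i)]) s')
      \<in> query_space n \<Otimes>\<^sub>M memory L \<rightarrow>\<^sub>M prob_algebra (transcript_space MH)"
    by (rule step[OF int])
qed

section \<open>The active learner built from \<open>\<A>\<close> and its output law\<close>

text \<open>Histories carry the discrete sigma-algebra, so the next query is measurable in the view,
  and the rebuilt database is measurable coordinate by coordinate. The bound
  \<open>m \<le> n\<close> keeps every queried index in \<open>{1..n}\<close>.\<close>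

lemma interactive_learner_active_of_ssl:
  assumes A: "\<A> \<in> ssl_database_space n MX \<rightarrow>\<^sub>M prob_algebra MH"
    and "m \<le> n"
  shows "interactive_learner n MX MH (active_of_ssl n m \<A>)"
proof -
  let ?V = "view_space n MX (count_space (UNIV :: unit set))"
  have "(\<lambda>v. (\<lambda>i\<in>{1..n}. (fst v i, map_of (fst (snd v)) i))) \<in> ?V \<rightarrow>\<^sub>M ssl_database_space n MX"
    unfolding view_space_def ssl_database_space_def database_space_def
    by measurable
  from measurable_compose[OF this A]
  have h: "hypothesis (active_of_ssl n m \<A>) \<in> ?V \<rightarrow>\<^sub>M prob_algebra MH"
    by (simp add: active_of_ssl_def case_prod_unfold)
  have "(\<lambda>hist :: (nat \<times> bool) list.
      if length hist < m then Some (Suc (length hist)) else None)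
      \<in> count_space UNIV \<rightarrow>\<^sub>M query_space n"
    using \<open>m \<le> n\<close> by (auto simp: query_space_def)
  then have [measurable]: "(\<lambda>v. if length (fst (snd v)) < m then Some (Suc (length (fst (snd v)))) else None)
      \<in> ?V \<rightarrow>\<^sub>M query_space n"
    unfolding view_space_def
    by (rule measurable_compose[rotated]) measurable
  have "(\<lambda>v. (if length (fst (snd v)) < m then Some (Suc (length (fst (snd v)))) else None, ()))
      \<in> ?V \<rightarrow>\<^sub>M query_space n \<Otimes>\<^sub>M count_space UNIV"
    by measurable
  from measurable_compose[OF this measurable_return_prob_space]
  have "query (active_of_ssl n m \<A>)
      \<in> ?V \<rightarrow>\<^sub>M prob_algebra (query_space n \<Otimes>\<^sub>M count_space UNIV)"
    by (simp add: active_of_ssl_def case_prod_unfold)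
  with h show ?thesis
    by (simp add: interactive_learner_def active_of_ssl_def)
qed

text \<open>The input that reaches \<open>\<A>\<close>, with the labels beyond \<open>m\<close>
  erased. The labels \<open>y\<close> need not come from a concept: accuracy takes
  \<open>y i = c (x i)\<close>, which gives \<open>ssl_sample\<close>, while privacy takes arbitrary
  labels.\<close>

definition revealed ::
    "nat \<Rightarrow> nat \<Rightarrow> (nat \<Rightarrow> bool) \<Rightarrow> (nat \<Rightarrow> 'x) \<Rightarrow> (nat \<Rightarrow> 'x \<times> bool option)" where
  "revealed n m y D = (\<lambda>i\<in>{1..n}. (D i, if i \<le> m then Some (y i) else None))"

lemma revealed_in_ssl_databases:
  assumes "D \<in> space (database_space n MX)"
  shows "revealed n m y D \<in> ssl_databases n m MX"
  using assms
  by (auto simp: revealed_def ssl_databases_def ssl_database_space_def database_space_def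
      space_PiM space_pair_measure)

text \<open>Every query is a point mass, so each bind collapses and randomness enters only through
  the final call of \<open>\<A>\<close>.\<close>

lemma execution_active_of_ssl:
  assumes A: "\<A> \<in> ssl_database_space n MX \<rightarrow>\<^sub>M prob_algebra MH"
    and "m \<le> n" and D: "D \<in> space (database_space n MX)"
  shows "execution MH m (active_of_ssl n m \<A>) y D =
    distr (\<A> (revealed n m y D)) (transcript_space MH) (\<lambda>h. (h, [1..<Suc m]))"
proof -
  let ?L = "active_of_ssl n m \<A>"
  let ?hist = "\<lambda>k. map (\<lambda>i. (i, y i)) [1..<Suc k]"
  have L: "interactive_learner n MX MH ?L"
    by (rule interactive_learner_active_of_ssl[OF A \<open>m \<le> n\<close>])
  \<comment> \<open>Induction on the number \<open>k\<close> of rounds left, when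
    \<open>m - k\<close> queries have been answered; \<open>k = m\<close> is the start with the
    empty history.\<close>
  have "interact MH ?L y D k (?hist (m - k)) () = finish MH ?L (D, ?hist m, ())" if "k \<le> m" for k
    using that
  proof (induction k)
    case 0
    show ?case
      by simp
  next
    case (Suc k)
    \<comment> \<open>Trades truncated subtraction for a successor: the history has length
      \<open>j\<close>, so the next query is \<open>Suc j\<close>, which is
      \<open>m - k\<close>.\<close>
    define j where "j = m - Suc k"
    have j: "m - Suc k = j" "m - k = Suc j" "j < m"
      using Suc.prems by (auto simp: j_def)
    have q: "query ?L (D, ?hist (m - Suc k), ()) =
        return (query_space n \<Otimes>\<^sub>M count_space UNIV) (Some (m - k), ())"
      using j by (simp add: active_of_ssl_def del: upt_Suc)
    have hist: "?hist (m - Suc k) @ [(m - k, y (m - k))] = ?hist (m - k)"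
      by (simp add: j)
    have "(Some (m - k), ()) \<in> space (query_space n \<Otimes>\<^sub>M count_space UNIV)"
      using Suc.prems \<open>m \<le> n\<close> by (auto simp: query_space_def space_pair_measure intro!: imageI)
    moreover have "memory ?L = count_space UNIV"
      by (simp add: active_of_ssl_def)
    ultimately have "interact MH ?L y D (Suc k) (?hist (m - Suc k)) () =
        interact MH ?L y D k (?hist (m - Suc k) @ [(m - k, y (m - k))]) ()"
      \<comment> \<open>Collapsing the point mass requires a measurable continuation and a point
        inside the query space; the latter holds because
        \<open>1 \<le> m - k \<le> n\<close>.\<close>
      using measurable_prob_algebraD[OF measurable_interact(2)[OF L D]]
      unfolding interact.simps q
      by (subst bind_return) auto
    also have "\<dots> = finish MH ?L (D, ?hist m, ())"
      unfolding hist using Suc by simp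
    finally show ?case .
  qed
  from this[of m] have "execution MH m ?L y D = finish MH ?L (D, ?hist m, ())"
    by (simp add: execution_def active_of_ssl_def)
  also have "\<dots> = distr (hypothesis ?L (D, ?hist m, ())) (transcript_space MH)
      (\<lambda>h. (h, [1..<Suc m]))"
    using D by (subst finish_eq_distr[OF L])
      (auto simp: view_space_def space_pair_measure active_of_ssl_def comp_def simp del: upt_Suc)
  \<comment> \<open>The lookup tests \<open>i \<in> {1..m}\<close> and \<open>revealed\<close> tests
    \<open>i \<le> m\<close>; these agree on the indices \<open>{1..n}\<close> of the
    database.\<close>
  also have "hypothesis ?L (D, ?hist m, ()) = \<A> (revealed n m y D)"
    unfolding active_of_ssl_def revealed_def interactive_learner.simps prod.case map_of_map_Pair_upt
    by (auto intro!: arg_cong[where f = \<A>])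
  finally show ?thesis .
qed

lemma measurable_Pair_transcript:
  "(\<lambda>h. (h, t)) \<in> MH \<rightarrow>\<^sub>M transcript_space MH"
  unfolding transcript_space_def by measurable

text \<open>Erasure acts entry by entry, so only the one differing index \<open>i\<close> can still
  differ. The results coincide exactly when \<open>i > m\<close> and the entries at \<open>i\<close>
  differ only in their labels.\<close>

lemma revealed_neighboring:
  fixes m :: nat
  assumes "neighboring n S\<^sub>1 S\<^sub>2"
  defines "R \<equiv> \<lambda>S. revealed n m (\<lambda>i. snd (S i)) (\<lambda>i\<in>{1..n}. fst (S i))"
  shows "R S\<^sub>1 = R S\<^sub>2 \<or> neighboring n (R S\<^sub>1) (R S\<^sub>2)"
proof -
  obtain i where i: "i \<in> {1..n}" "S\<^sub>1 i \<noteq> S\<^sub>2 i"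
    and uniq: "\<And>j. j \<in> {1..n} \<Longrightarrow> j \<noteq> i \<Longrightarrow> S\<^sub>1 j = S\<^sub>2 j"
    using assms(1) unfolding neighboring_def by metis
  \<comment> \<open>This includes indices outside \<open>{1..n}\<close>, about which
    \<open>neighboring\<close> says nothing: both restricted functions are \<open>undefined\<close>
    there. Equality as functions depends on it.\<close>
  have eq: "R S\<^sub>1 j = R S\<^sub>2 j" if "j \<noteq> i" for j
    using uniq that by (auto simp: R_def revealed_def restrict_def)
  show ?thesis
  proof (cases "R S\<^sub>1 i = R S\<^sub>2 i")
    case True
    with eq have "R S\<^sub>1 = R S\<^sub>2"
      by (intro ext) metis
    then show ?thesis ..
  next
    case False
    with eq i have "neighboring n (R S\<^sub>1) (R S\<^sub>2)"
      unfolding neighboring_def by (intro ex1I[of _ i]) blast+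
    then show ?thesis ..
  qed
qed

section \<open>Accuracy\<close>

text \<open>Pairing with the transcript is the same map for every sample, so it commutes with
  averaging over the sample. The bound \<open>\<beta>\<close> on the failure of \<open>\<A>\<close>
  then transfers through complements.\<close>

lemma AL_active_of_ssl:
  assumes C: "concept_class MX C" and H: "hypothesis_space MX C MH"
    and ssl: "SSL \<alpha> \<beta> n m MX MH C \<A>"
  shows "AL \<alpha> \<beta> n m MX MH C (active_of_ssl n m \<A>)"
  unfolding AL_def
proof (intro conjI ballI allI impI)
  have mn: "m \<le> n" and A: "\<A> \<in> ssl_database_space n MX \<rightarrow>\<^sub>M prob_algebra MH"
    using ssl by (auto simp: SSL_def)
  show "interactive_learner n MX MH (active_of_ssl n m \<A>)"
    by (rule interactive_learner_active_of_ssl[OF A mn])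
  fix c \<mu> assume c: "c \<in> C" and \<mu>: "distribution_on MX \<mu>"
  let ?B = "database_space n \<mu> \<bind> (\<lambda>x. \<A> (ssl_sample n m c x))"
  let ?t = "[1..<Suc m]"
  have [measurable]: "c \<in> MX \<rightarrow>\<^sub>M count_space UNIV"
    using C c by (auto simp: concept_class_def)
  have [measurable]: "error \<mu> c \<in> borel_measurable MH"
    using H c \<mu> by (auto simp: hypothesis_space_def)
  have sets_\<mu>: "sets \<mu> = sets MX" and "prob_space \<mu>"
    using \<mu> by (auto simp: distribution_on_def)
  \<comment> \<open>Measurability of \<open>\<A>\<close> is known over \<open>MX\<close>; equal
    sigma-algebras carry it over to samples from \<open>\<mu>\<close>.\<close>
  have sets_db: "sets (database_space n \<mu>) = sets (database_space n MX)"
    unfolding database_space_def by (rule sets_PiM_cong) (simp_all add: sets_\<mu>)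
  interpret db: prob_space "database_space n \<mu>"
    unfolding database_space_def by (rule prob_space_PiM) (rule \<open>prob_space \<mu>\<close>)
  have "ssl_sample n m c \<in> database_space n MX \<rightarrow>\<^sub>M ssl_database_space n MX"
    unfolding ssl_sample_def ssl_database_space_def database_space_def by measurable
  then have AS: "(\<lambda>x. \<A> (ssl_sample n m c x)) \<in> database_space n \<mu> \<rightarrow>\<^sub>M prob_algebra MH"
    unfolding measurable_cong_sets[OF sets_db refl] by (rule measurable_compose[OF _ A])
  have db: "database_space n \<mu> \<in> space (prob_algebra (database_space n \<mu>))"
    by (simp add: space_prob_algebra db.prob_space_axioms)
  interpret B: prob_space ?B
    by (rule prob_space_bind'[OF db AS])
  have sets_B: "sets ?B = sets MH"
    by (rule sets_bind'[OF db AS])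
  then have space_B: "space ?B = space MH"
    by (rule sets_eq_imp_space_eq)
  have "execution MH m (active_of_ssl n m \<A>) (\<lambda>i. c (x i)) x =
      distr (\<A> (ssl_sample n m c x)) (transcript_space MH) (\<lambda>h. (h, ?t))"
    if "x \<in> space (database_space n \<mu>)" for x
    using execution_active_of_ssl[OF A mn, of x] that
    by (simp add: revealed_def ssl_sample_def sets_eq_imp_space_eq[OF sets_db])
  then have "database_space n \<mu> \<bind> (\<lambda>x. execution MH m (active_of_ssl n m \<A>) (\<lambda>i. c (x i)) x) =
      database_space n \<mu> \<bind>
        (\<lambda>x. distr (\<A> (ssl_sample n m c x)) (transcript_space MH) (\<lambda>h. (h, ?t)))"
    by (intro bind_cong refl)
  also have "\<dots> = distr ?B (transcript_space MH) (\<lambda>h. (h, ?t))"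
    by (rule distr_bind[symmetric, OF measurable_prob_algebraD[OF AS] db.not_empty
          measurable_Pair_transcript])
  finally have exec: "database_space n \<mu> \<bind>
      (\<lambda>x. execution MH m (active_of_ssl n m \<A>) (\<lambda>i. c (x i)) x) =
      distr ?B (transcript_space MH) (\<lambda>h. (h, ?t))" .
  \<comment> \<open>Evaluating the push-forward on the accurate outputs requires them to form an
    event; this rests on the measurability of \<open>error \<mu> c\<close>.\<close>
  have good: "{(h, t). h \<in> space MH \<and> error \<mu> c h \<le> \<alpha>} \<in> sets (transcript_space MH)"
  proof -
    have "{v \<in> space (transcript_space MH). error \<mu> c (fst v) \<le> \<alpha>} \<in> sets (transcript_space MH)"
      unfolding transcript_space_def by measurable
    also have "{v \<in> space (transcript_space MH). error \<mu> c (fst v) \<le> \<alpha>} =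
        {(h, t). h \<in> space MH \<and> error \<mu> c h \<le> \<alpha>}"
      by (auto simp: transcript_space_def space_pair_measure)
    finally show ?thesis .
  qed
  have bad: "{h \<in> space MH. error \<mu> c h > \<alpha>} \<in> B.events"
    unfolding sets_B by measurable
  have "(\<lambda>h. (h, ?t)) \<in> ?B \<rightarrow>\<^sub>M transcript_space MH"
    unfolding measurable_cong_sets[OF sets_B refl] by (rule measurable_Pair_transcript)
  \<comment> \<open>The preimage of the accurate outputs under the pairing is the complement of the
    failure event in \<open>space MH\<close>.\<close>
  from measure_distr[OF this good]
  have "measure (distr ?B (transcript_space MH) (\<lambda>h. (h, ?t)))
      {(h, t). h \<in> space MH \<and> error \<mu> c h \<le> \<alpha>} = B.prob (space ?B - {h \<in> space MH. error \<mu> c h > \<alpha>})"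
    unfolding space_B by (auto intro!: arg_cong[where f = B.prob])
  also have "\<dots> = 1 - B.prob {h \<in> space MH. error \<mu> c h > \<alpha>}"
    by (rule B.prob_compl[OF bad])
  also have "\<dots> \<ge> 1 - \<beta>"
    using ssl c \<mu> by (auto simp: SSL_def)
  finally show "1 - \<beta> \<le> measure (database_space n \<mu> \<bind>
      (\<lambda>x. execution MH m (active_of_ssl n m \<A>) (\<lambda>i. c (x i)) x))
      {(h, t). h \<in> space MH \<and> error \<mu> c h \<le> \<alpha>}"
    unfolding exec .
qed

section \<open>Privacy\<close>

text \<open>Publishing a constant transcript costs no privacy: for both databases, an event
  \<open>F\<close> about hypothesis and transcript becomes the same event about the hypothesis
  alone, namely the section of \<open>F\<close> at the transcript
  \<open>[1..<Suc m]\<close>.\<close>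

lemma differentially_private_active_of_ssl:
  fixes MX :: "'x measure"
  assumes "\<epsilon> \<ge> 0" and "\<delta> \<ge> 0" and mn: "m \<le> n"
    and A: "\<A> \<in> ssl_database_space n MX \<rightarrow>\<^sub>M prob_algebra MH"
    and dp: "differentially_private \<epsilon> \<delta> n (ssl_databases n m MX) MH \<A>"
  shows "differentially_private \<epsilon> \<delta> n (space (database_space n (MX \<Otimes>\<^sub>M count_space UNIV)))
    (transcript_space MH) (transcript_algorithm MH n m (active_of_ssl n m \<A>))"
  unfolding differentially_private_def
proof (intro ballI impI)
  fix S\<^sub>1 S\<^sub>2 :: "nat \<Rightarrow> 'x \<times> bool" and F
  assume S: "S\<^sub>1 \<in> space (database_space n (MX \<Otimes>\<^sub>M count_space UNIV))"
      "S\<^sub>2 \<in> space (database_space n (MX \<Otimes>\<^sub>M count_space UNIV))"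
    and nb: "neighboring n S\<^sub>1 S\<^sub>2" and F: "F \<in> sets (transcript_space MH)"
  define R where "R S = revealed n m (\<lambda>i. snd (S i)) (\<lambda>i\<in>{1..n}. fst (S i))"
    for S :: "nat \<Rightarrow> 'x \<times> bool"
  let ?F = "(\<lambda>h. (h, [1..<Suc m])) -` F \<inter> space MH"
  have D: "(\<lambda>i\<in>{1..n}. fst (S i)) \<in> space (database_space n MX)"
    if "S \<in> space (database_space n (MX \<Otimes>\<^sub>M count_space UNIV))" for S :: "nat \<Rightarrow> 'x \<times> bool"
    using that by (fastforce simp: database_space_def space_PiM space_pair_measure PiE_iff)
  \<comment> \<open>Privacy of \<open>\<A>\<close> is available only on databases labeled exactly up
    to \<open>m\<close>.\<close>
  have R: "R S \<in> ssl_databases n m MX"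
    if "S \<in> space (database_space n (MX \<Otimes>\<^sub>M count_space UNIV))" for S
    unfolding R_def by (rule revealed_in_ssl_databases[OF D[OF that]])
  have meas: "measure (transcript_algorithm MH n m (active_of_ssl n m \<A>) S) F = measure (\<A> (R S)) ?F"
    if "S \<in> space (database_space n (MX \<Otimes>\<^sub>M count_space UNIV))" for S
  proof -
    have "\<A> (R S) \<in> space (prob_algebra MH)"
      using R[OF that] by (intro measurable_space[OF A]) (simp add: ssl_databases_def)
    then have sets: "sets (\<A> (R S)) = sets MH"
      by (simp add: space_prob_algebra)
    have "(\<lambda>h. (h, [1..<Suc m])) \<in> \<A> (R S) \<rightarrow>\<^sub>M transcript_space MH"
      unfolding measurable_cong_sets[OF sets refl] by (rule measurable_Pair_transcript)
    then show ?thesis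
      unfolding transcript_algorithm_def execution_active_of_ssl[OF A mn D[OF that]]
        R_def[symmetric] sets_eq_imp_space_eq[OF sets, symmetric]
      using F by (rule measure_distr)
  qed
  have F': "?F \<in> sets MH"
    by (rule measurable_sets[OF measurable_Pair_transcript F])
  have "measure (\<A> (R S\<^sub>1)) ?F \<le> exp \<epsilon> * measure (\<A> (R S\<^sub>2)) ?F + \<delta>"
  proof (cases "R S\<^sub>1 = R S\<^sub>2")
    \<comment> \<open>Equal databases are not neighbors, so privacy of \<open>\<A>\<close> says
      nothing here; \<open>exp \<epsilon> \<ge> 1\<close> gives the bound.\<close>
    case True
    have "1 * measure (\<A> (R S\<^sub>2)) ?F \<le> exp \<epsilon> * measure (\<A> (R S\<^sub>2)) ?F"
      using \<open>\<epsilon> \<ge> 0\<close> by (intro mult_right_mono) auto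
    with True \<open>\<delta> \<ge> 0\<close> show ?thesis
      by simp
  next
    case False
    then have "neighboring n (R S\<^sub>1) (R S\<^sub>2)"
      using revealed_neighboring[OF nb, of m] by (simp add: R_def)
    with dp R[OF S(1)] R[OF S(2)] F' show ?thesis
      unfolding differentially_private_def by blast
  qed
  then show "measure (transcript_algorithm MH n m (active_of_ssl n m \<A>) S\<^sub>1) F
      \<le> exp \<epsilon> * measure (transcript_algorithm MH n m (active_of_ssl n m \<A>) S\<^sub>2) F + \<delta>"
    unfolding meas[OF S(1)] meas[OF S(2)] .
qed

theorem theorem5p5:
  fixes MX :: "'x measure" and MH :: "('x \<Rightarrow> bool) measure" and C :: "('x \<Rightarrow> bool) set"
    and \<A> :: "(nat \<Rightarrow> 'x \<times> bool option) \<Rightarrow> ('x \<Rightarrow> bool) measure"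
    and \<alpha> \<beta> \<epsilon> \<delta> :: real and n m :: nat
  assumes "concept_class MX C"
    and "hypothesis_space MX C MH"
    and "\<epsilon> \<ge> 0" and "\<delta> \<ge> 0"
    and "PSSL \<alpha> \<beta> \<epsilon> \<delta> n m MX MH C \<A>"
  shows "TPAL \<alpha> \<beta> \<epsilon> \<delta> n m MX MH C (active_of_ssl n m \<A>)"
  \<comment> \<open>The bound \<open>m \<le> n\<close> and the measurability of \<open>\<A>\<close>
    required by the privacy lemma are contained in \<open>SSL\<close>.\<close>
  using assms AL_active_of_ssl differentially_private_active_of_ssl
  unfolding TPAL_def PSSL_def SSL_def by blast

end
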